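(* Consider a market for a single risky asset with non-constant payoff $S:D\to\mathbb{R}$ on a finite state space $D$, $|D|\ge2$, with $\underline S=\min_{s\in D}S_s$, $\overline S=\max_{s\in D}S_s$, and with $m\ge 2$ investors indexed by $i\in\mathcal{I}=\{1,\dots,m\}$. Suppose the supply is $\theta_0=0$ and that $\alpha_i\in[1/2,1]$ for each $i\in\mathcal{I}$. Then there exists an equilibrium price $\pi^*\in(\underline S,\overline S)$, i.e. a price with $\sum_{i\in\mathcal I}\theta_i^*(\pi^* )=0$. The equilibrium positions $(\theta_i^*(\pi^* ))_{i\in\mathcal I}$ are different from zero (i.e. not all zero) if and only if at least two investors' reservation intervals do not overlap, that is, $$\min_{i\in\mathcal I}\overline\pi_i<\max_{i\in\mathcal I}\underline\pi_i .$$
   Context: Investor $i$ has a reference probability measure $\mathbb{P}_0^i=(p^i_{0s})_{s\in D}$ with all $p_{0s}^i>0$, a divergence parameter $c_i\ge1$ with $c_i<\min_{s\in D}\frac1{1-p^i_{0s}}$, an ambiguity parameter $\alpha_i\in[0,1]$, initial wealth $w_i$, and a strictly increasing, strictly concave, twice differentiable utility function $u_i$; none of these need coincide across investors. At price $\pi$, investor $i$'s objective is $$V_{\alpha_i}(\theta)=\alpha_i\min_{P\in\mathcal{X}_i}\mathbb{E}_P[u_i(w_i+\theta(S-\pi))]+(1-\alpha_i)\max_{P\in\mathcal{X}_i}\mathbb{E}_P[u_i(w_i+\theta(S-\pi))],$$ with $\mathcal{X}_i=\{P: P(s)\ge 0\ \forall s\in D,\ \sum_{s}P(s)=1,\ \sum_{s}P(s)^2/p^i_{0s}\le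 c_i\}$. Either $u_i$ is defined on $\mathbb{R}$ and the admissible set is $\Theta_i=\mathbb{R}$ (case 1), or $u_i$ is defined only on $(0,\infty)$, $w_i>0$ and $\Theta_i=\{\theta\in\mathbb{R}: w_i+\theta(S_s-\pi)>0\ \forall s\in D\}$ (case 2). Each $u_i$ satisfies the Inada conditions: $\lim_{x\downarrow-\infty}u_i'(x)=+\infty$ in case 1, $\lim_{x\downarrow0}u_i'(x)=+\infty$ in case 2, and $\lim_{x\uparrow\infty}u_i'(x)=0$ in both cases. For $\alpha_i\ge1/2$, $\theta_i^*(\pi)$ denotes the (unique) maximizer of $V_{\alpha_i}$ over $\Theta_i$ at price $\pi\in(\underline S,\overline S)$. With $\mathbb{E}_i,\mathbb{S}_i$ the expectation and standard deviation under $\mathbb{P}_0^i$ and $\delta_i=\sqrt{c_i-1}(2\alpha_i-1)$, set $$\overline\pi_i=\mathbb{E}_i[S]+|\delta_i|\,\mathbb{S}_i[S],\qquad\underline\pi_i=\mathbb{E}_i[S]-|\delta_i|\,\mathbb{S}_i[S];$$ $[\underline\pi_i,\overline\pi_i]$ is the reservation interval of investor $i$. *)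

theory Defs
  imports "HOL-Analysis.Analysis"
begin

text \<open>The state space is the finite type \<open>'d\<close>; measures on it are given by their weights.\<close>

definition expect :: "('d::finite \<Rightarrow> real) \<Rightarrow> ('d \<Rightarrow> real) \<Rightarrow> real" where
  "expect P X = (\<Sum>s\<in>UNIV. P s * X s)"

definition std_dev :: "('d::finite \<Rightarrow> real) \<Rightarrow> ('d \<Rightarrow> real) \<Rightarrow> real" where
  "std_dev P X = sqrt (expect P (\<lambda>s. (X s - expect P X)\<^sup>2))"

definition prob_vector :: "('d::finite \<Rightarrow> real) \<Rightarrow> bool" where
  "prob_vector P \<longleftrightarrow> (\<forall>s. 0 \<le> P s) \<and> (\<Sum>s\<in>UNIV. P s) = 1"

definition strictly_concave_on :: "real set \<Rightarrow> (real \<Rightarrow> real) \<Rightarrow> bool" where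
  "strictly_concave_on A f \<longleftrightarrow> convex A \<and>
     (\<forall>x\<in>A. \<forall>y\<in>A. \<forall>t. x \<noteq> y \<longrightarrow> 0 < t \<longrightarrow> t < 1 \<longrightarrow>
        (1 - t) * f x + t * f y < f ((1 - t) * x + t * y))"

text \<open>\<open>udom\<close> is the domain of the utility function: the whole line (case 1) or the open positive
  half-line (case 2). The values of the total function \<open>util\<close> outside \<open>udom\<close> are never used.\<close>

record 'd investor =
  ref :: "'d \<Rightarrow> real"
  cdiv :: real
  ambig :: real
  wealth :: real
  udom :: "real set"
  util :: "real \<Rightarrow> real"

definition ambiguity_set :: "'d::finite investor \<Rightarrow> ('d \<Rightarrow> real) set" where
  "ambiguity_set a = {P. prob_vector P \<and> (\<Sum>s\<in>UNIV. (P s)\<^sup>2 / ref a s) \<le> cdiv a}"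

definition utility_ok :: "real set \<Rightarrow> (real \<Rightarrow> real) \<Rightarrow> bool" where
  "utility_ok A u \<longleftrightarrow>
     strict_mono_on A u \<and> strictly_concave_on A u \<and>
     (\<forall>x\<in>A. u differentiable (at x) \<and> deriv u differentiable (at x)) \<and>
     filterlim (deriv u) at_top (if A = UNIV then at_bot else at_right 0) \<and>
     (deriv u \<longlongrightarrow> 0) at_top"

definition investor_ok :: "'d::finite investor \<Rightarrow> bool" where
  "investor_ok a \<longleftrightarrow>
     prob_vector (ref a) \<and> (\<forall>s. 0 < ref a s) \<and>
     1 \<le> cdiv a \<and> cdiv a < Min (range (\<lambda>s. 1 / (1 - ref a s))) \<and>
     0 \<le> ambig a \<and> ambig a \<le> 1 \<and>
     (udom a = UNIV \<or> udom a = {0<..} \<and> 0 < wealth a) \<and>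
     utility_ok (udom a) (util a)"

definition terminal_wealth ::
    "'d::finite investor \<Rightarrow> ('d \<Rightarrow> real) \<Rightarrow> real \<Rightarrow> real \<Rightarrow> 'd \<Rightarrow> real" where
  "terminal_wealth a S \<pi> \<theta> s = wealth a + \<theta> * (S s - \<pi>)"

definition admissible :: "'d::finite investor \<Rightarrow> ('d \<Rightarrow> real) \<Rightarrow> real \<Rightarrow> real set" where
  "admissible a S \<pi> = {\<theta>. \<forall>s. terminal_wealth a S \<pi> \<theta> s \<in> udom a}"

text \<open>The infimum and supremum are attained; see \<open>objective_extrema_attained\<close> below.\<close>

definition objective ::
    "'d::finite investor \<Rightarrow> ('d \<Rightarrow> real) \<Rightarrow> real \<Rightarrow> real \<Rightarrow> real" where
  "objective a S \<pi> \<theta> =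
     ambig a * (INF P\<in>ambiguity_set a. expect P (\<lambda>s. util a (terminal_wealth a S \<pi> \<theta> s)))
     + (1 - ambig a) * (SUP P\<in>ambiguity_set a. expect P (\<lambda>s. util a (terminal_wealth a S \<pi> \<theta> s)))"

definition optimal_position :: "'d::finite investor \<Rightarrow> ('d \<Rightarrow> real) \<Rightarrow> real \<Rightarrow> real" where
  "optimal_position a S \<pi> = arg_max_on (objective a S \<pi>) (admissible a S \<pi>)"

text \<open>The unique-maximizer clause makes \<open>optimal_position\<close>, which is a choice, well defined.\<close>

definition equilibrium_price ::
    "(nat \<Rightarrow> 'd::finite investor) \<Rightarrow> nat \<Rightarrow> ('d \<Rightarrow> real) \<Rightarrow> real \<Rightarrow> real \<Rightarrow> bool" where
  "equilibrium_price agent m S \<theta>\<^sub>0 \<pi> \<longleftrightarrow>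
     Min (range S) < \<pi> \<and> \<pi> < Max (range S) \<and>
     (\<forall>i\<in>{1..m}. \<exists>!\<theta>. is_arg_max (objective (agent i) S \<pi>) (\<lambda>\<theta>. \<theta> \<in> admissible (agent i) S \<pi>) \<theta>) \<and>
     (\<Sum>i=1..m. optimal_position (agent i) S \<pi>) = \<theta>\<^sub>0"

definition delta :: "'d investor \<Rightarrow> real" where
  "delta a = sqrt (cdiv a - 1) * (2 * ambig a - 1)"

definition upper_reservation :: "'d::finite investor \<Rightarrow> ('d \<Rightarrow> real) \<Rightarrow> real" where
  "upper_reservation a S = expect (ref a) S + \<bar>delta a\<bar> * std_dev (ref a) S"

definition lower_reservation :: "'d::finite investor \<Rightarrow> ('d \<Rightarrow> real) \<Rightarrow> real" where
  "lower_reservation a S = expect (ref a) S - \<bar>delta a\<bar> * std_dev (ref a) S"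

lemma objective_extrema_attained:
  fixes a :: "'d::finite investor" and f :: "'d \<Rightarrow> real"
  assumes "investor_ok a"
  shows "\<exists>P\<in>ambiguity_set a. expect P f = (INF Q\<in>ambiguity_set a. expect Q f)"
    and "\<exists>P\<in>ambiguity_set a. expect P f = (SUP Q\<in>ambiguity_set a. expect Q f)"
proof -
  define K where "K = {v :: real^'d. (\<lambda>s. v $ s) \<in> ambiguity_set a}"
  define g where "g = (\<lambda>v :: real^'d. expect (\<lambda>s. v $ s) f)"
  have "ref a \<in> ambiguity_set a"
    using assms by (auto simp: investor_ok_def ambiguity_set_def prob_vector_def power2_eq_square less_imp_neq[THEN not_sym])
  then have "(\<chi> s. ref a s) \<in> K" by (simp add: K_def vec_lambda_inverse)
  then have ne: "K \<noteq> {}" by blast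
  have img: "(\<lambda>Q. expect Q f) ` ambiguity_set a = g ` K"
  proof (intro equalityI subsetI)
    fix x assume "x \<in> (\<lambda>Q. expect Q f) ` ambiguity_set a"
    then obtain Q where "Q \<in> ambiguity_set a" "x = expect Q f" by blast
    then show "x \<in> g ` K"
      by (intro image_eqI[of _ _ "\<chi> s. Q s"]) (auto simp: g_def K_def vec_lambda_inverse)
  qed (auto simp: g_def K_def vec_lambda_inverse)
  have "closed K"
    unfolding K_def ambiguity_set_def prob_vector_def mem_Collect_eq
    by (intro closed_Collect_conj closed_Collect_all closed_Collect_le closed_Collect_eq
        continuous_intros) (use assms in \<open>auto simp: investor_ok_def less_imp_neq[THEN not_sym]\<close>)
  moreover have "norm v \<le> 1" if "v \<in> K" for v
  proof -
    from that have v: "\<forall>s. 0 \<le> v $ s" "(\<Sum>s\<in>UNIV. v $ s) = 1"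
      by (auto simp: K_def ambiguity_set_def prob_vector_def)
    have "norm v \<le> (\<Sum>s\<in>UNIV. \<bar>v $ s\<bar>)" by (rule norm_le_l1_cart)
    also have "\<dots> = 1" using v by simp
    finally show ?thesis .
  qed
  ultimately have "compact K"
    by (auto simp: compact_eq_bounded_closed bounded_iff)
  moreover have "continuous_on K g"
    unfolding g_def expect_def by (intro continuous_intros)
  ultimately obtain x y where
    x: "x \<in> K" "\<forall>z\<in>K. g x \<le> g z" and y: "y \<in> K" "\<forall>z\<in>K. g z \<le> g y"
    using continuous_attains_inf[OF _ ne] continuous_attains_sup[OF _ ne] by metis
  have "Inf (g ` K) = g x"
    by (rule cInf_eq_minimum) (use x in auto)
  then show "\<exists>P\<in>ambiguity_set a. expect P f = (INF Q\<in>ambiguity_set a. expect Q f)"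
    using x(1) by (auto simp: img) (auto simp: g_def K_def vec_lambda_inverse)
  have "Sup (g ` K) = g y"
    by (rule cSup_eq_maximum) (use y in auto)
  then show "\<exists>P\<in>ambiguity_set a. expect P f = (SUP Q\<in>ambiguity_set a. expect Q f)"
    using y(1) by (auto simp: img) (auto simp: g_def K_def vec_lambda_inverse)
qed

end

theory Submission
  imports Defs
begin

text \<open>The bound on \<open>c\<close> makes the nonnegativity constraints of the chi-square ball inactive, so that by
  Cauchy-Schwarz its extreme expectations are the mean plus or minus \<open>sqrt (c - 1)\<close> standard
  deviations, and for \<open>\<alpha> \<ge> 1/2\<close> the objective is again a worst-case expected utility, over the smaller
  ball of radius \<open>1 + \<delta>\<^sup>2\<close>, all of whose members are strictly positive. The objective is therefore
  strictly concave. Since marginal utility explodes at the lower end of the domain, it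
  decreases far out in both directions, which gives a unique maximizer. Its sign is that of the
  marginal utility of trading at \<open>\<theta> = 0\<close>: positive below, negative above and zero on the reservation
  interval. As the maximizer is continuous in the price, aggregate demand vanishes somewhere between
  the smallest lower and the largest upper reservation price. If the positions at an equilibrium are
  not all zero, one investor buys and another sells, so their intervals lie on either side of the price.\<close>

section \<open>Worst-case expectations over a chi-square ball\<close>

lemma expect_diff: "expect P (\<lambda>s. f s - g s) = expect P f - expect P g"
  by (simp add: expect_def algebra_simps sum_subtractf)

lemma expect_add: "expect P (\<lambda>s. f s + g s) = expect P f + expect P g"
  by (simp add: expect_def algebra_simps sum.distrib)

lemma expect_minus: "expect P (\<lambda>s. - f s) = - expect P f"
  by (simp add: expect_def sum_negf)

lemma expect_scale: "expect P (\<lambda>s. c * f s) = c * expect P f"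
  by (simp add: expect_def sum_distrib_left algebra_simps)

lemma expect_const: "prob_vector P \<Longrightarrow> expect P (\<lambda>s. c) = c"
  by (simp add: expect_def prob_vector_def flip: sum_distrib_right)

lemma std_dev_minus: "std_dev P (\<lambda>s. - f s) = std_dev P f"
  by (simp add: std_dev_def expect_minus power2_commute)

text \<open>For \<open>r = sqrt (c - 1)\<close> the condition \<open>r_small\<close> is the bound on
  the divergence parameter \<open>c\<close>. Keeping \<open>r\<close> free lets one theory serve
  both the ambiguity set and the smaller ball of radius \<open>delta a\<close>.\<close>

locale chi_square_ball =
  fixes p :: "'d::finite \<Rightarrow> real" and r :: real
  assumes prob: "prob_vector p"
    and pos: "0 < p s"
    and r_nonneg: "0 \<le> r"
    and r_small: "(1 + r\<^sup>2) * (1 - p s) < 1"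
begin

definition chi_ball :: "('d \<Rightarrow> real) set" where
  "chi_ball = {P. prob_vector P \<and> (\<Sum>s\<in>UNIV. (P s)\<^sup>2 / p s) \<le> 1 + r\<^sup>2}"

text \<open>The closed form of the minimal expectation over \<open>chi_ball\<close>, as
  \<open>worst_le\<close> and \<open>worst_attained\<close> show. The formula makes continuity and
  scaling immediate.\<close>

definition worst :: "('d \<Rightarrow> real) \<Rightarrow> real" where
  "worst f = expect p f - r * std_dev p f"

lemma sum_p: "(\<Sum>s\<in>UNIV. p s) = 1"
  using prob by (simp add: prob_vector_def)

lemma chi_square_eq:
  assumes "(\<Sum>s\<in>UNIV. P s) = 1"
  shows "(\<Sum>s\<in>UNIV. (P s - p s)\<^sup>2 / p s) = (\<Sum>s\<in>UNIV. (P s)\<^sup>2 / p s) - 1"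
proof -
  have "(P s - p s)\<^sup>2 / p s = (P s)\<^sup>2 / p s - 2 * P s + p s" for s
    using pos[of s] by (simp add: power2_eq_square field_simps)
  then show ?thesis
    using assms sum_p
    by (simp add: sum.distrib sum_subtractf flip: sum_distrib_left)
qed

text \<open>Cauchy-Schwarz on the complement of \<open>s\<close> bounds
  \<open>(1 - P s)\<^sup>2\<close> by \<open>(1 - p s) * (1 + r\<^sup>2)\<close>. No sign of
  \<open>P\<close> enters, so this also proves positivity of a candidate measure; the bound is
  uniform over the ball.\<close>

lemma weight_ge:
  assumes "(\<Sum>s\<in>UNIV. P s) = 1" and le: "(\<Sum>s\<in>UNIV. (P s)\<^sup>2 / p s) \<le> 1 + r\<^sup>2"
  shows "1 - sqrt ((1 + r\<^sup>2) * (1 - p s)) \<le> P s"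
proof -
  have P: "(\<Sum>t\<in>-{s}. P t) = 1 - P s" and p: "(\<Sum>t\<in>-{s}. p t) = 1 - p s"
    using assms(1) sum_p
    by (simp_all add: Compl_eq_Diff_UNIV sum_diff)
  have "(\<Sum>t\<in>-{s}. sqrt (p t) * (P t / sqrt (p t)))\<^sup>2
      \<le> (\<Sum>t\<in>-{s}. (sqrt (p t))\<^sup>2) * (\<Sum>t\<in>-{s}. (P t / sqrt (p t))\<^sup>2)"
    by (rule Cauchy_Schwarz_ineq_sum)
  moreover have "sqrt (p t) * (P t / sqrt (p t)) = P t" "(sqrt (p t))\<^sup>2 = p t"
    "(P t / sqrt (p t))\<^sup>2 = (P t)\<^sup>2 / p t" for t
    using pos[of t] by (simp_all add: power_divide less_imp_le)
  ultimately have "(1 - P s)\<^sup>2 \<le> (1 - p s) * (\<Sum>t\<in>-{s}. (P t)\<^sup>2 / p t)"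
    by (simp add: P p)
  also have "\<dots> \<le> (1 - p s) * (1 + r\<^sup>2)"
  proof (rule mult_left_mono)
    have "(\<Sum>t\<in>-{s}. (P t)\<^sup>2 / p t) \<le> (\<Sum>t\<in>UNIV. (P t)\<^sup>2 / p t)"
      by (rule sum_mono2) (auto intro!: divide_nonneg_pos pos)
    then show "(\<Sum>t\<in>-{s}. (P t)\<^sup>2 / p t) \<le> 1 + r\<^sup>2" using le by simp
    show "0 \<le> 1 - p s" unfolding p[symmetric] by (intro sum_nonneg less_imp_le pos)
  qed
  finally have "\<bar>1 - P s\<bar> \<le> sqrt ((1 + r\<^sup>2) * (1 - p s))"
    by (metis real_sqrt_abs real_sqrt_le_iff mult.commute)
  then show ?thesis by linarith
qed

lemma weight_bound_pos: "0 < 1 - sqrt ((1 + r\<^sup>2) * (1 - p s))"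
  using r_small[of s] by simp

lemma chi_ball_prob: "P \<in> chi_ball \<Longrightarrow> prob_vector P"
  by (simp add: chi_ball_def)

lemma chi_ball_weight_ge: "P \<in> chi_ball \<Longrightarrow> 1 - sqrt ((1 + r\<^sup>2) * (1 - p s)) \<le> P s"
  by (intro weight_ge) (auto simp: chi_ball_def prob_vector_def)

lemma chi_ball_pos: "P \<in> chi_ball \<Longrightarrow> 0 < P s"
  using chi_ball_weight_ge weight_bound_pos by (rule less_le_trans[rotated])

text \<open>Cauchy-Schwarz between the deviation \<open>p - P\<close>, scaled by
  \<open>1 / sqrt p\<close>, and the centred payoff, scaled by \<open>sqrt p\<close>: the first norm
  is at most \<open>r\<close>, the second is the standard deviation.\<close>

lemma worst_le:
  assumes "P \<in> chi_ball"
  shows "worst f \<le> expect P f"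
proof -
  have sP: "(\<Sum>s\<in>UNIV. P s) = 1" using assms by (simp add: chi_ball_def prob_vector_def)
  let ?g = "\<lambda>s. f s - expect p f"
  \<comment> \<open>Centring \<open>f\<close> changes nothing because \<open>p\<close> and
    \<open>P\<close> have the same total mass.\<close>
  have "expect p f - expect P f = (\<Sum>s\<in>UNIV. (p s - P s) * ?g s)"
  proof -
    have "(\<Sum>s\<in>UNIV. (p s - P s) * ?g s)
        = (expect p f - expect P f) - ((\<Sum>s\<in>UNIV. p s) - (\<Sum>s\<in>UNIV. P s)) * expect p f"
      unfolding expect_def[of P f] expect_def[of p f] sum_distrib_right left_diff_distrib
      by (simp add: algebra_simps sum.distrib sum_subtractf sum_distrib_left)
    then show ?thesis using sP sum_p by simp
  qed
  also have "\<dots> = (\<Sum>s\<in>UNIV. ((p s - P s) / sqrt (p s)) * (sqrt (p s) * ?g s))"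
    using pos by (intro sum.cong) (auto simp: less_imp_neq[THEN not_sym])
  also have "\<dots> \<le> sqrt ((\<Sum>s\<in>UNIV. ((p s - P s) / sqrt (p s))\<^sup>2) * (\<Sum>s\<in>UNIV. (sqrt (p s) * ?g s)\<^sup>2))"
    by (intro real_le_rsqrt Cauchy_Schwarz_ineq_sum)
  also have "\<dots> = sqrt (\<Sum>s\<in>UNIV. (P s - p s)\<^sup>2 / p s) * std_dev p f"
    using pos by (simp add: real_sqrt_mult std_dev_def expect_def power_divide power_mult_distrib
        less_imp_le power2_commute)
  also have "\<dots> \<le> r * std_dev p f"
  proof (rule mult_right_mono)
    show "sqrt (\<Sum>s\<in>UNIV. (P s - p s)\<^sup>2 / p s) \<le> r"
      using assms r_nonneg by (intro real_le_lsqrt) (auto simp: chi_square_eq[OF sP] chi_ball_def)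
    show "0 \<le> std_dev p f"
      by (auto simp: std_dev_def expect_def intro!: sum_nonneg mult_nonneg_nonneg less_imp_le[OF pos])
  qed
  finally show ?thesis by (simp add: worst_def)
qed

text \<open>The extremal measure is the reference measure tilted linearly in \<^term>\<open>f\<close>; the bound on \<^term>\<open>r\<close>
  is what keeps its weights positive.\<close>

lemma worst_attained: "\<exists>P\<in>chi_ball. expect P f = worst f"
\<comment> \<open>The tilt divides by the standard deviation; if that vanishes, the reference
  measure itself attains the value.\<close>
proof (cases "std_dev p f = 0")
  case True
  have "(p s)\<^sup>2 / p s = p s" for s using pos[of s] by (simp add: power2_eq_square)
  then have "p \<in> chi_ball" using prob sum_p by (simp add: chi_ball_def)
  then show ?thesis using True by (auto simp: worst_def)
next
  case False
  define \<sigma> where "\<sigma> = std_dev p f"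
  define g where "g = (\<lambda>s. f s - expect p f)"
  define P where "P = (\<lambda>s. p s - r / \<sigma> * (p s * g s))"
  have \<sigma>: "\<sigma> \<noteq> 0" "\<sigma>\<^sup>2 = (\<Sum>s\<in>UNIV. p s * (g s)\<^sup>2)"
    using False pos
    by (auto simp: \<sigma>_def g_def std_dev_def expect_def less_imp_le intro!: real_sqrt_pow2 sum_nonneg mult_nonneg_nonneg)
  have g0: "(\<Sum>s\<in>UNIV. p s * g s) = 0"
    using expect_diff[of p f "\<lambda>_. expect p f"] expect_const[OF prob]
    by (simp add: g_def expect_def)
  have sP: "(\<Sum>s\<in>UNIV. P s) = 1"
    using g0 sum_p unfolding P_def sum_subtractf sum_distrib_left[symmetric] by simp
  have "(P s - p s)\<^sup>2 / p s = (r / \<sigma>)\<^sup>2 * (p s * (g s)\<^sup>2)" for s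
    using pos[of s] by (simp add: P_def power2_eq_square field_simps)
  then have "(\<Sum>s\<in>UNIV. (P s - p s)\<^sup>2 / p s) = (r / \<sigma>)\<^sup>2 * \<sigma>\<^sup>2"
    by (simp add: \<sigma>(2) sum_distrib_left)
  then have chi: "(\<Sum>s\<in>UNIV. (P s)\<^sup>2 / p s) = 1 + r\<^sup>2"
    using \<sigma>(1) by (simp add: chi_square_eq[OF sP] power_divide)
  have "0 < P s" for s
    using weight_ge[OF sP eq_refl[OF chi], of s] weight_bound_pos[of s] by linarith
  then have PB: "P \<in> chi_ball" using sP chi by (auto simp: chi_ball_def prob_vector_def less_imp_le)
  have "(\<Sum>s\<in>UNIV. p s * g s * f s) = (\<Sum>s\<in>UNIV. p s * (g s)\<^sup>2 + expect p f * (p s * g s))"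
    by (intro sum.cong) (auto simp: g_def power2_eq_square algebra_simps)
  also have "\<dots> = \<sigma>\<^sup>2"
    by (simp add: sum.distrib g0 \<sigma>(2) flip: sum_distrib_left)
  finally have "(\<Sum>s\<in>UNIV. p s * g s * f s) = \<sigma>\<^sup>2" .
  moreover have "expect P f = expect p f - r / \<sigma> * (\<Sum>s\<in>UNIV. p s * g s * f s)"
    by (simp add: P_def expect_def algebra_simps sum_subtractf sum_distrib_left)
  ultimately have "expect P f = worst f"
    using \<sigma>(1) by (simp add: worst_def \<sigma>_def[symmetric] power2_eq_square)
  then show ?thesis using PB by blast
qed

lemma INF_expect: "(INF P\<in>chi_ball. expect P f) = worst f"
  using worst_attained[of f] worst_le by (intro cInf_eq_minimum) (force, auto)

lemma SUP_expect: "(SUP P\<in>chi_ball. expect P f) = expect p f + r * std_dev p f"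
proof -
  have *: "worst (\<lambda>s. - f s) = - (expect p f + r * std_dev p f)"
    by (simp add: worst_def expect_minus std_dev_minus)
  show ?thesis
    using worst_attained[of "\<lambda>s. - f s"] worst_le[of _ "\<lambda>s. - f s"]
    by (intro cSup_eq_maximum) (force simp: * expect_minus)+
qed

lemma worst_const: "worst (\<lambda>s. c) = c"
  using prob by (simp add: worst_def std_dev_def expect_const)

lemma worst_scale: 
  assumes "0 \<le> c" 
  shows "worst (\<lambda>s. c * f s) = c * worst f"
proof -
  have "std_dev p (\<lambda>s. c * f s) = c * std_dev p f"
    using assms by (simp add: std_dev_def expect_scale power_mult_distrib real_sqrt_mult
        flip: right_diff_distrib)
  then show ?thesis by (simp add: worst_def expect_scale right_diff_distrib)
qed

lemma worst_shift: "worst (\<lambda>s. f s - c) = worst f - c"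
  using prob by (simp add: worst_def std_dev_def expect_diff expect_const)

lemma tendsto_worst:
  assumes "\<And>s. ((\<lambda>t. f t s) \<longlongrightarrow> g s) F"
  shows "((\<lambda>t. worst (f t)) \<longlongrightarrow> worst g) F"
  unfolding worst_def std_dev_def expect_def by (intro tendsto_intros assms)

text \<open>The minimizing measure charges every state, in particular one where \<open>f\<close>
  exceeds its minimum.\<close>

lemma Min_less_worst:
  assumes "f s \<noteq> f t"
  shows "Min (range f) < worst f"
proof -
  obtain P where P: "P \<in> chi_ball" "expect P f = worst f" using worst_attained by blast
  define l where "l = Min (range f)"
  have l: "l \<le> f s" for s by (simp add: l_def)
  obtain s0 where "l < f s0"
    using assms l[of s] l[of t] by (metis less_le)
  then have "0 < (\<Sum>s\<in>UNIV. P s * (f s - l))"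
    using P(1) l by (intro sum_pos2[of _ s0]) (auto intro: mult_pos_pos mult_nonneg_nonneg less_imp_le[OF chi_ball_pos] chi_ball_pos)
  also have "\<dots> = expect P f - l"
    using expect_diff[of P f "\<lambda>_. l"] expect_const[OF chi_ball_prob[OF P(1)]] by (simp add: expect_def)
  finally show ?thesis using P(2) by (simp add: l_def)
qed

end

section \<open>Optimal position of one investor\<close>

text \<open>Shrinking the radius by \<open>k\<close> keeps the bound. The choice
  \<open>k = 1\<close> gives the ambiguity set, \<open>k = 2 * ambig a - 1\<close> the ball of
  radius \<open>delta a\<close>.\<close>

lemma investor_chi_square_ball:
  assumes ok: "investor_ok a" and k: "0 \<le> k" "k \<le> 1"
  shows "chi_square_ball (ref a) (sqrt (cdiv a - 1) * k)"
proof
  show "prob_vector (ref a)" "0 < ref a s" for s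
    using ok by (auto simp: investor_ok_def)
  have c: "1 \<le> cdiv a" using ok by (simp add: investor_ok_def)
  then show "0 \<le> sqrt (cdiv a - 1) * k" using k by simp
  fix s
  have lt: "cdiv a < 1 / (1 - ref a s)" using ok by (simp add: investor_ok_def)
  \<comment> \<open>The value \<open>ref a s = 1\<close> is excluded by the convention
    \<open>1 / 0 = 0\<close>, since \<open>1 \<le> cdiv a\<close>.\<close>
  then have p: "ref a s < 1" using c
    by (metis diff_gt_0_iff_gt less_trans zero_less_divide_1_iff less_le_trans zero_less_one)
  have "(cdiv a - 1) * k\<^sup>2 \<le> (cdiv a - 1) * 1"
    using c k by (intro mult_left_mono power_le_one) auto
  then have "1 + (sqrt (cdiv a - 1) * k)\<^sup>2 \<le> cdiv a"
    using c by (simp add: power_mult_distrib)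
  then have "(1 + (sqrt (cdiv a - 1) * k)\<^sup>2) * (1 - ref a s) \<le> cdiv a * (1 - ref a s)"
    using p by (intro mult_right_mono) auto
  also have "\<dots> < 1" using lt p by (simp add: field_simps)
  finally show "(1 + (sqrt (cdiv a - 1) * k)\<^sup>2) * (1 - ref a s) < 1" .
qed

locale averse_investor =
  fixes a :: "'d::finite investor"
  assumes ok: "investor_ok a" and averse: "1 / 2 \<le> ambig a"
begin

lemma cdiv_ge: "1 \<le> cdiv a" and ambig_le: "ambig a \<le> 1"
  using ok by (auto simp: investor_ok_def)

lemma delta_nonneg: "0 \<le> delta a"
  using averse cdiv_ge by (simp add: delta_def)

end

sublocale averse_investor \<subseteq> chi_square_ball "ref a" "delta a"
  unfolding delta_def
  by (intro investor_chi_square_ball) (use ok averse ambig_le in auto)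

context averse_investor
begin

text \<open>The argument \<open>X\<close> stands for the excess payoff \<open>S - \<pi>\<close>. A
  short position in \<open>X\<close> is then a long one in \<open>- X\<close>, and dependence on the
  price becomes dependence on \<open>X\<close>.\<close>

definition V :: "('d \<Rightarrow> real) \<Rightarrow> real \<Rightarrow> real" where
  "V X \<theta> = worst (\<lambda>s. util a (wealth a + \<theta> * X s))"

definition adm :: "('d \<Rightarrow> real) \<Rightarrow> real set" where
  "adm X = {\<theta>. \<forall>s. wealth a + \<theta> * X s \<in> udom a}"

text \<open>Minimum and maximum are mean minus and plus \<open>sqrt (c - 1)\<close> deviations, so
  their mixture is the mean minus \<open>(2 * \<alpha> - 1) * sqrt (c - 1)\<close> deviations, which
  is \<open>worst\<close> with radius \<open>delta a\<close>.\<close>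

lemma objective_eq: "objective a S \<pi> = V (\<lambda>s. S s - \<pi>)"
proof
  fix \<theta>
  interpret full: chi_square_ball "ref a" "sqrt (cdiv a - 1)"
    using investor_chi_square_ball[OF ok, of 1] by simp
  have "ambiguity_set a = full.chi_ball"
    using cdiv_ge by (simp add: ambiguity_set_def full.chi_ball_def)
  then show "objective a S \<pi> \<theta> = V (\<lambda>s. S s - \<pi>) \<theta>"
    unfolding V_def worst_def unfolding delta_def
    by (simp add: objective_def full.INF_expect full.SUP_expect full.worst_def
        terminal_wealth_def[abs_def] algebra_simps)
qed

lemma admissible_eq: "admissible a S \<pi> = adm (\<lambda>s. S s - \<pi>)"
  by (simp add: admissible_def adm_def terminal_wealth_def)

section \<open>Utility and marginal utility on the domain\<close>

lemma wealth_dom: "wealth a \<in> udom a"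
  using ok by (auto simp: investor_ok_def)

lemma dom_cases: "udom a = UNIV \<or> udom a = {0<..}"
  using ok by (auto simp: investor_ok_def)

lemma open_dom: "open (udom a)"
  using dom_cases by (metis open_UNIV open_greaterThan)

lemma convex_dom: "convex (udom a)"
  using dom_cases by (metis convex_UNIV convex_real_interval(3))

lemma dom_upward: "x \<in> udom a \<Longrightarrow> x \<le> y \<Longrightarrow> y \<in> udom a"
  using dom_cases by (metis UNIV_I greaterThan_iff less_le_trans)

lemma util_ok: "utility_ok (udom a) (util a)"
  using ok by (simp add: investor_ok_def)

lemma util_deriv: "x \<in> udom a \<Longrightarrow> (util a has_real_derivative deriv (util a) x) (at x)"
  using util_ok by (simp add: utility_ok_def DERIV_deriv_iff_real_differentiable)

lemma util_cont: "x \<in> udom a \<Longrightarrow> isCont (util a) x"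
  using util_deriv DERIV_isCont by blast

lemma deriv_util_cont: "x \<in> udom a \<Longrightarrow> isCont (deriv (util a)) x"
  using util_ok differentiable_imp_continuous_within[of "deriv (util a)" x UNIV]
  by (simp add: utility_ok_def)

lemma tangent:
  assumes "x \<in> udom a" "y \<in> udom a"
  shows "util a y \<le> util a x + deriv (util a) x * (y - x)"
proof -
  have conc: "strictly_concave_on (udom a) (util a)"
    using util_ok by (simp add: utility_ok_def)
  have "convex_on (udom a) (\<lambda>x. - util a x)"
  proof (rule convex_onI)
    fix t x y :: real assume "0 < t" "t < 1" "x \<in> udom a" "y \<in> udom a"
    then show "- util a ((1 - t) *\<^sub>R x + t *\<^sub>R y) \<le> (1 - t) * - util a x + t * - util a y"
    \<comment> \<open>Strict concavity speaks of distinct points only.\<close>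
    proof (cases "x = y")
      case True
      then show ?thesis by (simp add: algebra_simps)
    next
      case False
      then have "(1 - t) * util a x + t * util a y < util a ((1 - t) * x + t * y)"
        using conc \<open>0 < t\<close> \<open>t < 1\<close> \<open>x \<in> udom a\<close> \<open>y \<in> udom a\<close>
        by (simp add: strictly_concave_on_def)
      then show ?thesis by simp
    qed
  qed (rule convex_dom)
  then have "- deriv (util a) x * (y - x) \<le> - util a y - - util a x"
    using assms open_dom convex_dom
    by (intro convex_on_imp_above_tangent[where A = "udom a"]
        has_field_derivative_at_within[OF DERIV_minus[OF util_deriv]])
      (simp_all add: interior_open convex_connected)
  then show ?thesis by simp
qed

text \<open>Add the tangent inequalities at \<open>x\<close> and at \<open>y\<close>.\<close>

lemma deriv_util_antimono:
  assumes "x \<in> udom a" "x \<le> y"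
  shows "deriv (util a) y \<le> deriv (util a) x"
proof (cases "x = y")
  case False
  have y: "y \<in> udom a" using assms dom_upward by blast
  have "(deriv (util a) y - deriv (util a) x) * (y - x) \<le> 0"
    using tangent[OF assms(1) y] tangent[OF y assms(1)] by (simp add: algebra_simps)
  then show ?thesis using False assms(2) by (simp add: mult_le_0_iff)
qed simp

lemma deriv_util_pos:
  assumes "x \<in> udom a"
  shows "0 < deriv (util a) x"
proof -
  have x: "x + 1 \<in> udom a" using assms dom_upward[of x "x + 1"] by simp
  then have "util a x < util a (x + 1)"
    using util_ok assms by (auto simp: utility_ok_def strict_mono_on_def)
  then show ?thesis using tangent[OF assms x] by simp
qed

text \<open>Unifies the two Inada cases. Since \<open>y\<close> lies at or below initial wealth, a
  nonnegative position can bring wealth down to \<open>y\<close> in a losing state.\<close>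

lemma inada: "\<exists>y\<in>udom a. y \<le> wealth a \<and> M \<le> deriv (util a) y"
proof -
  have lim: "filterlim (deriv (util a)) at_top (if udom a = UNIV then at_bot else at_right 0)"
    using util_ok by (simp add: utility_ok_def)
  from dom_cases show ?thesis
  proof
    assume A: "udom a = UNIV"
    have "\<forall>\<^sub>F y in at_bot. M \<le> deriv (util a) y"
      using lim A by (simp add: filterlim_at_top)
    moreover have "\<forall>\<^sub>F y in at_bot. y \<le> wealth a" by (rule eventually_le_at_bot)
    ultimately have "\<forall>\<^sub>F y in at_bot. y \<le> wealth a \<and> M \<le> deriv (util a) y"
      by eventually_elim simp
    from eventually_happens[OF this] show ?thesis using A by auto
  next
    assume A: "udom a = {0<..}"
    then have "udom a \<noteq> UNIV" by (metis UNIV_I greaterThan_iff less_irrefl)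
    then have "\<forall>\<^sub>F y in at_right 0. M \<le> deriv (util a) y"
      using lim by (simp add: filterlim_at_top)
    moreover have "\<forall>\<^sub>F y in at_right 0. y \<in> {0<..<wealth a}"
      using wealth_dom A by (intro eventually_at_right_real) simp
    ultimately have "\<forall>\<^sub>F y in at_right 0. y \<in> udom a \<and> y \<le> wealth a \<and> M \<le> deriv (util a) y"
      by eventually_elim (simp add: A)
    from eventually_happens[OF this] show ?thesis by auto
  qed
qed

section \<open>Admissible positions, concavity and supergradients of the objective\<close>

lemma zero_adm: "0 \<in> adm X"
  by (simp add: adm_def wealth_dom)

lemma V_zero: "V X 0 = util a (wealth a)"
  by (simp add: V_def worst_const)

lemma adm_dom: "\<theta> \<in> adm X \<Longrightarrow> wealth a + \<theta> * X s \<in> udom a"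
  by (simp add: adm_def)

lemma adm_mix_eq:
  "wealth a + ((1 - t) * x + t * y) * c = (1 - t) * (wealth a + x * c) + t * (wealth a + y * c)"
  by (simp add: algebra_simps)

lemma adm_mix:
  assumes "x \<in> adm X" "y \<in> adm X" "0 \<le> t" "t \<le> 1"
  shows "(1 - t) * x + t * y \<in> adm X"
  unfolding adm_def mem_Collect_eq adm_mix_eq
  using convexD_alt[OF convex_dom adm_dom[OF assms(1)] adm_dom[OF assms(2)] assms(3,4)] by simp

lemma convex_adm: "convex (adm X)"
  unfolding convex_alt using adm_mix by auto

lemma adm_between: "x \<in> adm X \<Longrightarrow> y \<in> adm X \<Longrightarrow> x \<le> z \<Longrightarrow> z \<le> y \<Longrightarrow> z \<in> adm X"
  using convex_adm[of X] by (meson is_interval_convex_1 mem_is_interval_1_I)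

lemma open_adm: "open (adm X)"
proof -
  have "open ((\<lambda>\<theta>. wealth a + \<theta> * X s) -` udom a)" for s
    by (intro open_vimage open_dom continuous_intros)
  moreover have "adm X = (\<Inter>s. (\<lambda>\<theta>. wealth a + \<theta> * X s) -` udom a)"
    by (auto simp: adm_def)
  ultimately show ?thesis by (simp add: open_INT)
qed

text \<open>Fix the measure that is worst at the mixed position; at \<open>x\<close> and
  \<open>y\<close> it only overestimates \<open>V\<close>. Utility is strictly concave along the
  mixture in state \<open>s0\<close>, and that state has positive weight.\<close>

lemma V_strict_concave:
  assumes xy: "x \<in> adm X" "y \<in> adm X" "x \<noteq> y" and t: "0 < t" "t < 1" and X: "X s0 \<noteq> 0"
  shows "(1 - t) * V X x + t * V X y < V X ((1 - t) * x + t * y)"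
proof -
  let ?f = "\<lambda>\<theta> s. util a (wealth a + \<theta> * X s)"
  let ?z = "(1 - t) * x + t * y"
  obtain P where P: "P \<in> chi_ball" "expect P (?f ?z) = V X ?z"
    using worst_attained[of "?f ?z"] by (auto simp: V_def)
  have strict: "(1 - t) * ?f x s + t * ?f y s < ?f ?z s" if "X s \<noteq> 0" for s
    using util_ok xy t that adm_dom[OF xy(1)] adm_dom[OF xy(2)]
    by (simp add: utility_ok_def strictly_concave_on_def adm_mix_eq)
  have weak: "(1 - t) * ?f x s + t * ?f y s \<le> ?f ?z s" for s
    using strict[of s] by (cases "X s = 0") (auto simp: algebra_simps)
  have "(1 - t) * V X x + t * V X y \<le> (1 - t) * expect P (?f x) + t * expect P (?f y)"
    using t worst_le[OF P(1)] unfolding V_def by (intro add_mono mult_left_mono) auto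
  also have "\<dots> = expect P (\<lambda>s. (1 - t) * ?f x s + t * ?f y s)"
    by (simp add: expect_add expect_scale)
  also have "\<dots> < expect P (?f ?z)"
    unfolding expect_def using chi_ball_pos[OF P(1)] strict[OF X] weak
    by (intro sum_strict_mono_ex1) (auto intro: mult_left_mono less_imp_le)
  finally show ?thesis by (simp add: P(2))
qed

lemma V_strict_quasiconcave:
  assumes "x \<in> adm X" "y \<in> adm X" "x < z" "z < y" and X: "X s0 \<noteq> 0"
  shows "min (V X x) (V X y) < V X z"
proof -
  define t where "t = (z - x) / (y - x)"
  have t: "0 < t" "t < 1" using assms by (auto simp: t_def)
  have "t * (y - x) = z - x" using assms by (simp add: t_def)
  then have z: "z = (1 - t) * x + t * y" by (simp add: algebra_simps)
  have "min (V X x) (V X y) = (1 - t) * min (V X x) (V X y) + t * min (V X x) (V X y)"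
    by (simp add: algebra_simps)
  also have "\<dots> \<le> (1 - t) * V X x + t * V X y"
    using t by (intro add_mono mult_left_mono) auto
  also have "\<dots> < V X z" unfolding z
    using assms t by (intro V_strict_concave) auto
  finally show ?thesis .
qed

text \<open>A supergradient inequality at \<open>x\<close>: take the measure that is worst at
  \<open>x\<close> and bound utility by its tangents there.\<close>

lemma V_step:
  assumes "x \<in> adm X" "y \<in> adm X"
  obtains P where "P \<in> chi_ball"
    "V X y \<le> V X x + (y - x) * expect P (\<lambda>s. X s * deriv (util a) (wealth a + x * X s))"
proof -
  let ?f = "\<lambda>\<theta> s. util a (wealth a + \<theta> * X s)"
  let ?g = "\<lambda>s. X s * deriv (util a) (wealth a + x * X s)"
  obtain P where P: "P \<in> chi_ball" "expect P (?f x) = V X x"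
    using worst_attained[of "?f x"] by (auto simp: V_def)
  have "V X y \<le> expect P (?f y)" using worst_le[OF P(1)] by (simp add: V_def)
  also have "\<dots> \<le> expect P (\<lambda>s. ?f x s + (y - x) * ?g s)"
    unfolding expect_def
  proof (intro sum_mono mult_left_mono less_imp_le[OF chi_ball_pos[OF P(1)]])
    fix s show "?f y s \<le> ?f x s + (y - x) * ?g s"
      using tangent[OF adm_dom[OF assms(1)] adm_dom[OF assms(2)], of s s] by (simp add: algebra_simps)
  qed
  also have "\<dots> = V X x + (y - x) * expect P ?g"
    unfolding expect_add expect_scale P(2) ..
  finally show ?thesis using that P(1) by blast
qed

text \<open>Tangents at initial wealth under an arbitrary measure of the ball: the gain over not
  trading is at most a positive multiple of \<open>\<theta> * expect P X\<close>.\<close>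

lemma V_le:
  assumes "\<theta> \<in> adm X" "P \<in> chi_ball"
  shows "V X \<theta> \<le> util a (wealth a) + \<theta> * deriv (util a) (wealth a) * expect P X"
proof -
  have "V X \<theta> \<le> expect P (\<lambda>s. util a (wealth a + \<theta> * X s))"
    using worst_le[OF assms(2)] by (simp add: V_def)
  also have "\<dots> \<le> expect P (\<lambda>s. util a (wealth a) + \<theta> * deriv (util a) (wealth a) * X s)"
    unfolding expect_def
  proof (intro sum_mono mult_left_mono less_imp_le[OF chi_ball_pos[OF assms(2)]])
    fix s show "util a (wealth a + \<theta> * X s) \<le> util a (wealth a) + \<theta> * deriv (util a) (wealth a) * X s"
      using tangent[OF wealth_dom adm_dom[OF assms(1)], of s] by (simp add: algebra_simps)
  qed
  also have "\<dots> = util a (wealth a) + \<theta> * deriv (util a) (wealth a) * expect P X"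
    using expect_const[OF chi_ball_prob[OF assms(2)], of "util a (wealth a)"]
    by (simp add: expect_add expect_scale)
  finally show ?thesis .
qed

text \<open>\<open>V_step\<close> taken backwards, from \<open>\<theta>\<close> to \<open>0\<close>,
  with the unknown measure replaced by the worst one.\<close>

lemma V_ge:
  assumes "\<theta> \<in> adm X" "0 \<le> \<theta>"
  shows "util a (wealth a) + \<theta> * worst (\<lambda>s. X s * deriv (util a) (wealth a + \<theta> * X s)) \<le> V X \<theta>"
proof -
  obtain P where P: "P \<in> chi_ball"
    "V X 0 \<le> V X \<theta> + (0 - \<theta>) * expect P (\<lambda>s. X s * deriv (util a) (wealth a + \<theta> * X s))"
    using V_step[OF assms(1) zero_adm] by blast
  then show ?thesis
    using mult_left_mono[OF worst_le[OF P(1), of "\<lambda>s. X s * deriv (util a) (wealth a + \<theta> * X s)"] assms(2)]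
    by (simp add: V_zero)
qed

lemma tendsto_V:
  assumes "\<And>s. ((\<lambda>t. Y t s) \<longlongrightarrow> X s) F" "(\<theta> \<longlongrightarrow> \<theta>0) F" "\<theta>0 \<in> adm X"
  shows "((\<lambda>t. V (Y t) (\<theta> t)) \<longlongrightarrow> V X \<theta>0) F"
  unfolding V_def
  by (intro tendsto_worst isCont_tendsto_compose[OF util_cont] adm_dom tendsto_intros assms)

lemma continuous_on_V: "continuous_on (adm X) (V X)"
  unfolding continuous_on_def by (intro ballI tendsto_V tendsto_intros)

section \<open>Behaviour far out, existence and uniqueness of the maximizer\<close>

lemma eventually_decreasing:
  assumes "X s1 < 0"
  shows "\<exists>x\<in>adm X. 0 \<le> x \<and> (\<forall>y\<in>adm X. x < y \<longrightarrow> V X y < V X x)"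
proof -
  obtain s0 where s0: "\<And>s. X s0 \<le> X s"
    using ex_is_arg_min_if_finite[of UNIV X] by (auto simp: is_arg_min_linorder)
  have neg: "X s0 < 0" using s0[of s1] assms by simp
  \<comment> \<open>\<open>\<eta>\<close> bounds the weight of the worst state \<open>s0\<close>
    from below over the whole ball; \<open>C\<close> bounds the total marginal gain from the other
    states.\<close>
  define \<eta> where "\<eta> = 1 - sqrt ((1 + (delta a)\<^sup>2) * (1 - ref a s0))"
  define D where "D = deriv (util a) (wealth a)"
  define C where "C = (\<Sum>s\<in>UNIV. \<bar>X s\<bar> * D)"
  have \<eta>: "0 < \<eta>" unfolding \<eta>_def by (rule weight_bound_pos)
  have D: "0 < D" unfolding D_def by (intro deriv_util_pos wealth_dom)
  have C: "0 \<le> C" unfolding C_def using D by (intro sum_nonneg) simp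
  \<comment> \<open>The threshold makes the marginal loss in \<open>s0\<close> at least
    \<open>C + 1\<close>, outweighing all gains; the extra \<open>1\<close> gives
    strictness.\<close>
  obtain y where y: "y \<in> udom a" "y \<le> wealth a" "(C + 1) / (\<eta> * - X s0) \<le> deriv (util a) y"
    using inada by blast
  \<comment> \<open>The position whose terminal wealth in \<open>s0\<close> is exactly
    \<open>y\<close>; all other states end at or above \<open>y\<close>.\<close>
  define x where "x = (wealth a - y) / - X s0"
  have x0: "0 \<le> x" using y(2) neg unfolding x_def by (intro divide_nonneg_pos) auto
  have xs0: "wealth a + x * X s0 = y" using neg by (simp add: x_def)
  have x_adm: "x \<in> adm X"
    unfolding adm_def mem_Collect_eq
  proof
    fix s show "wealth a + x * X s \<in> udom a"
      using mult_left_mono[OF s0 x0, of s] xs0 by (intro dom_upward[OF y(1)]) linarith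
  qed
  let ?g = "\<lambda>s. X s * deriv (util a) (wealth a + x * X s)"
  have neg_sum: "expect P ?g < 0" if P: "P \<in> chi_ball" for P
  proof -
    have P1: "P s \<le> 1" for s
      using member_le_sum[of s UNIV P] chi_ball_prob[OF P] by (simp add: prob_vector_def)
    \<comment> \<open>In a gaining state wealth has risen, so marginal utility is at most
      \<open>D\<close>; in a losing state the term is nonpositive.\<close>
    have term_le: "P s * ?g s \<le> \<bar>X s\<bar> * D" for s
    proof (cases "0 \<le> X s")
      case True
      have "deriv (util a) (wealth a + x * X s) \<le> D"
        unfolding D_def using True x0 by (intro deriv_util_antimono wealth_dom) simp
      then have "P s * ?g s \<le> 1 * (\<bar>X s\<bar> * D)"
        using True P1 D deriv_util_pos[OF adm_dom[OF x_adm, of s]]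
        by (intro mult_mono) (auto intro: mult_left_mono)
      then show ?thesis by simp
    next
      case False
      then have "P s * ?g s \<le> 0"
        using deriv_util_pos[OF adm_dom[OF x_adm, of s]] chi_ball_pos[OF P, of s]
        by (intro mult_nonneg_nonpos mult_nonpos_nonneg) auto
      also have "0 \<le> \<bar>X s\<bar> * D" using D by simp
      finally show ?thesis .
    qed
    have "C + 1 \<le> \<eta> * (- X s0 * deriv (util a) y)"
    proof -
      have "0 < \<eta> * - X s0" using \<eta> neg by (intro mult_pos_pos) auto
      from y(3)[unfolded pos_divide_le_eq[OF this]] show ?thesis by (simp add: mult_ac)
    qed
    also have "\<dots> \<le> P s0 * (- X s0 * deriv (util a) y)"
      using chi_ball_weight_ge[OF P, of s0] neg deriv_util_pos[OF y(1)]
      by (intro mult_right_mono) (auto simp: \<eta>_def mult_nonpos_nonneg)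
    finally have s0_term: "P s0 * ?g s0 \<le> - (C + 1)" by (simp add: xs0)
    have "expect P ?g = P s0 * ?g s0 + (\<Sum>s\<in>-{s0}. P s * ?g s)"
      unfolding expect_def by (simp add: sum.remove[of UNIV s0] Compl_eq_Diff_UNIV)
    also have "\<dots> \<le> - (C + 1) + (\<Sum>s\<in>-{s0}. \<bar>X s\<bar> * D)"
      by (intro add_mono s0_term sum_mono term_le)
    also have "(\<Sum>s\<in>-{s0}. \<bar>X s\<bar> * D) \<le> C"
      unfolding C_def using D by (intro sum_mono2) auto
    finally show ?thesis by simp
  qed
  have "V X z < V X x" if z: "z \<in> adm X" "x < z" for z
  proof -
    obtain P where P: "P \<in> chi_ball" "V X z \<le> V X x + (z - x) * expect P ?g"
      using V_step[OF x_adm z(1)] by blast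
    have "(z - x) * expect P ?g < 0" using neg_sum[OF P(1)] z(2) by (intro mult_pos_neg) auto
    then show ?thesis using P(2) by linarith
  qed
  then show ?thesis using x_adm x0 by blast
qed

lemma V_minus: "V (\<lambda>s. - X s) \<theta> = V X (- \<theta>)"
  by (simp add: V_def)

lemma adm_minus: "\<theta> \<in> adm (\<lambda>s. - X s) \<longleftrightarrow> - \<theta> \<in> adm X"
  by (simp add: adm_def)

definition best :: "('d \<Rightarrow> real) \<Rightarrow> real" where
  "best X = arg_max_on (V X) (adm X)"

text \<open>Absence of arbitrage: for \<open>X = S - \<pi>\<close> the price lies strictly between
  the extreme payoffs.\<close>

definition mixed :: "('d \<Rightarrow> real) \<Rightarrow> bool" where
  "mixed X \<longleftrightarrow> (\<exists>s. X s < 0) \<and> (\<exists>s. 0 < X s)"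

lemma mixed_minus: "mixed X \<Longrightarrow> mixed (\<lambda>s. - X s)"
  by (auto simp: mixed_def)

text \<open>\<open>V X\<close> falls beyond \<open>x\<close> and, by reflection, below
  \<open>- x'\<close>, so a maximum over the compact interval between them is global. Two maximizers
  would be beaten by their midpoint.\<close>

lemma ex1_maximizer:
  assumes "mixed X"
  shows "\<exists>!\<theta>. is_arg_max (V X) (\<lambda>\<theta>. \<theta> \<in> adm X) \<theta>"
proof (rule ex_ex1I)
  obtain s1 s2 where s: "X s1 < 0" "0 < X s2" using assms by (auto simp: mixed_def)
  obtain x where x: "x \<in> adm X" "0 \<le> x" "\<And>y. y \<in> adm X \<Longrightarrow> x < y \<Longrightarrow> V X y < V X x"
    using eventually_decreasing[of X, OF s(1)] by blast
  obtain x' where x': "x' \<in> adm (\<lambda>s. - X s)" "0 \<le> x'"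
    "\<And>y. y \<in> adm (\<lambda>s. - X s) \<Longrightarrow> x' < y \<Longrightarrow> V (\<lambda>s. - X s) y < V (\<lambda>s. - X s) x'"
    using eventually_decreasing[of "\<lambda>s. - X s" s2] s(2) by auto
  have x'_adm: "- x' \<in> adm X" using x'(1) by (simp add: adm_minus)
  have below: "V X y < V X (- x')" if "y \<in> adm X" "y < - x'" for y
    using x'(3)[of "- y"] that by (simp add: V_minus adm_minus)
  have sub: "{- x'..x} \<subseteq> adm X"
    using adm_between[OF x'_adm x(1)] by auto
  have "compact {- x'..x}" "{- x'..x} \<noteq> {}" using x(2) x'(2) by auto
  then obtain z where z: "z \<in> {- x'..x}" "\<And>y. y \<in> {- x'..x} \<Longrightarrow> V X y \<le> V X z"
    using continuous_attains_sup[OF _ _ continuous_on_subset[OF continuous_on_V sub]] by blast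
  have "V X y \<le> V X z" if "y \<in> adm X" for y
    using that z(2)[of y] z(2)[of x] z(2)[of "- x'"] x(2,3) x'(2) below[of y]
    by (cases "y < - x'"; cases "x < y") force+
  then show "\<exists>\<theta>. is_arg_max (V X) (\<lambda>\<theta>. \<theta> \<in> adm X) \<theta>"
    using z(1) sub by (auto simp: is_arg_max_linorder intro!: exI[of _ z])
  fix v w assume vw: "is_arg_max (V X) (\<lambda>\<theta>. \<theta> \<in> adm X) v" "is_arg_max (V X) (\<lambda>\<theta>. \<theta> \<in> adm X) w"
  show "v = w"
  proof (rule ccontr)
    assume ne: "v \<noteq> w"
    have eq: "V X v = V X w" using vw by (auto simp: is_arg_max_linorder intro: antisym)
    have "(1 - 1/2) * V X v + 1/2 * V X w < V X ((1 - 1/2) * v + 1/2 * w)"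
      using vw ne s(1) by (intro V_strict_concave[where ?s0.0 = s1]) (auto simp: is_arg_max_linorder)
    moreover have "V X ((1 - 1/2) * v + 1/2 * w) \<le> V X v"
      using vw adm_mix[of v X w "1/2"] by (auto simp: is_arg_max_linorder)
    ultimately show False using eq by simp
  qed
qed

lemma best_is_arg_max: "mixed X \<Longrightarrow> is_arg_max (V X) (\<lambda>\<theta>. \<theta> \<in> adm X) (best X)"
  unfolding best_def arg_max_on_def arg_max_def
  by (rule someI_ex) (use ex1_maximizer in blast)

lemma best_adm: "mixed X \<Longrightarrow> best X \<in> adm X"
  and best_max: "mixed X \<Longrightarrow> \<theta> \<in> adm X \<Longrightarrow> V X \<theta> \<le> V X (best X)"
  using best_is_arg_max[of X] by (auto simp: is_arg_max_linorder)

lemma best_unique: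
  assumes "mixed X" "x \<in> adm X" "V X (best X) \<le> V X x"
  shows "x = best X"
proof -
  have "is_arg_max (V X) (\<lambda>\<theta>. \<theta> \<in> adm X) x"
    using assms best_max[OF assms(1)] by (force simp: is_arg_max_linorder)
  then show ?thesis using ex1_maximizer[OF assms(1)] best_is_arg_max[OF assms(1)] by blast
qed

lemma best_minus:
  assumes "mixed X"
  shows "best (\<lambda>s. - X s) = - best X"
proof -
  have "V (\<lambda>s. - X s) (best (\<lambda>s. - X s)) \<le> V X (best X)"
    using best_max[OF assms] best_adm[OF mixed_minus[OF assms]]
    by (simp add: V_minus adm_minus)
  then show ?thesis
    using best_unique[OF mixed_minus[OF assms], of "- best X"] best_adm[OF assms]
    by (simp add: V_minus adm_minus)
qed

text \<open>By \<open>V_ge\<close>, the average gain from a small long position is at least a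
  quantity tending to \<open>deriv (util a) (wealth a) * worst X\<close>, which is positive, so some
  such position beats not trading.\<close>

lemma best_pos:
  assumes X: "mixed X" and worst: "0 < worst X"
  shows "0 < best X"
proof -
  have lim: "((\<lambda>\<theta>. worst (\<lambda>s. X s * deriv (util a) (wealth a + \<theta> * X s))) \<longlongrightarrow>
      worst (\<lambda>s. X s * deriv (util a) (wealth a))) (at_right 0)"
    by (intro tendsto_worst tendsto_mult isCont_tendsto_compose[OF deriv_util_cont] wealth_dom)
      (auto intro!: tendsto_eq_intros)
  have "worst (\<lambda>s. X s * deriv (util a) (wealth a)) = deriv (util a) (wealth a) * worst X"
    using worst_scale[of "deriv (util a) (wealth a)" X] deriv_util_pos[OF wealth_dom]
    by (simp add: mult.commute)
  also have "0 < \<dots>"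
    using worst deriv_util_pos[OF wealth_dom] by simp
  finally have "\<forall>\<^sub>F \<theta> in at_right 0. 0 < worst (\<lambda>s. X s * deriv (util a) (wealth a + \<theta> * X s))"
    by (rule order_tendstoD(1)[OF lim])
  moreover have "\<forall>\<^sub>F \<theta> in at_right 0. \<theta> \<in> adm X"
    using open_adm zero_adm by (intro topological_tendstoD[OF tendsto_ident_at])
  moreover have "\<forall>\<^sub>F \<theta> in at_right 0. 0 < (\<theta>::real)"
    by (rule eventually_at_right_less)
  ultimately have "\<forall>\<^sub>F \<theta> in at_right 0. \<theta> \<in> adm X \<and> V X 0 < V X \<theta>"
  proof eventually_elim
    case (elim \<theta>)
    then have "0 < \<theta> * worst (\<lambda>s. X s * deriv (util a) (wealth a + \<theta> * X s))" by simp
    then show ?case using V_ge[of \<theta> X] elim unfolding V_zero by linarith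
  qed
  from eventually_happens[OF this] obtain \<theta> where \<theta>: "\<theta> \<in> adm X" "V X 0 < V X \<theta>"
    by auto
  \<comment> \<open>It remains to fix the sign: \<open>expect P X\<close> is positive for any
    \<open>P\<close> of the ball, so by \<open>V_le\<close> a positive gain forces a positive
    position.\<close>
  obtain P where P: "P \<in> chi_ball" using worst_attained by blast
  have "0 < deriv (util a) (wealth a) * expect P X"
    using worst_le[OF P, of X] worst deriv_util_pos[OF wealth_dom] by simp
  moreover have "0 < best X * (deriv (util a) (wealth a) * expect P X)"
    using V_le[OF best_adm[OF X] P] \<theta> best_max[OF X \<theta>(1)] by (simp add: V_zero mult.assoc)
  ultimately show ?thesis by (rule zero_less_mult_pos2[rotated])
qed

text \<open>Under the measure attaining \<open>worst X\<close> no long position gains in mean, hence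
  by \<open>V_le\<close> none beats \<open>0\<close>; uniqueness excludes a positive
  maximizer.\<close>

lemma best_nonpos:
  assumes X: "mixed X" and worst: "worst X \<le> 0"
  shows "best X \<le> 0"
proof (rule ccontr)
  assume "\<not> best X \<le> 0"
  then have pos: "0 < best X" by simp
  obtain P where P: "P \<in> chi_ball" "expect P X = worst X" using worst_attained by blast
  have "best X * deriv (util a) (wealth a) * expect P X \<le> 0"
    using pos P(2) worst deriv_util_pos[OF wealth_dom] by (intro mult_nonneg_nonpos) auto
  then have "V X (best X) \<le> V X 0"
    using V_le[OF best_adm[OF X] P(1)] by (simp add: V_zero)
  then show False using best_unique[OF X zero_adm] pos by simp
qed

lemma best_pos_iff: "mixed X \<Longrightarrow> 0 < best X \<longleftrightarrow> 0 < worst X"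
  using best_pos best_nonpos by (meson not_less)

text \<open>Pick \<open>k\<close> between \<open>l\<close> and \<open>best X\<close>. That
  \<open>best X\<close> strictly beats \<open>k\<close> persists for nearby payoffs; if
  \<open>best (Y t)\<close> lay below \<open>k\<close>, quasiconcavity would make \<open>k\<close>
  strictly better than \<open>best X\<close>.\<close>

lemma tendsto_best_lower:
  assumes X: "mixed X" and Y: "\<And>s. ((\<lambda>t. Y t s) \<longlongrightarrow> X s) F" and l: "l < best X"
  shows "\<forall>\<^sub>F t in F. mixed (Y t) \<and> l < best (Y t)"
proof -
  obtain e where e: "0 < e" "ball (best X) e \<subseteq> adm X"
    using open_adm best_adm[OF X] by (meson open_contains_ball)
  \<comment> \<open>The midpoint keeps \<open>k\<close> above \<open>l\<close>, the second entry
    keeps it inside the admissible ball.\<close>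
  define k where "k = max ((l + best X) / 2) (best X - e / 2)"
  have k: "l < k" "k < best X" "k \<in> adm X"
    using e l by (auto simp: k_def dist_real_def max_def subset_iff field_simps)
  have in_adm: "\<forall>\<^sub>F t in F. \<theta> \<in> adm (Y t)" if "\<theta> \<in> adm X" for \<theta>
  proof -
    have "\<forall>\<^sub>F t in F. wealth a + \<theta> * Y t s \<in> udom a" for s
      using adm_dom[OF that] open_dom
      by (intro topological_tendstoD[of _ "wealth a + \<theta> * X s"] tendsto_intros Y)
    then show ?thesis by (simp add: adm_def eventually_all_finite)
  qed
  obtain s1 s2 where s: "X s1 < 0" "0 < X s2" using X by (auto simp: mixed_def)
  have "V X k < V X (best X)"
    using best_unique[OF X k(3)] k(2) by fastforce
  then have "\<forall>\<^sub>F t in F. 0 < V (Y t) (best X) - V (Y t) k"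
    by (intro order_tendstoD(1)[of _ "V X (best X) - V X k"] tendsto_diff tendsto_V Y k best_adm X
        tendsto_const) simp
  moreover have "\<forall>\<^sub>F t in F. Y t s1 < 0" "\<forall>\<^sub>F t in F. 0 < Y t s2"
    using order_tendstoD(2)[OF Y s(1)] order_tendstoD(1)[OF Y s(2)] .
  moreover note in_adm[OF k(3)] in_adm[OF best_adm[OF X]]
  ultimately show ?thesis
  proof eventually_elim
    case (elim t)
    then have mix: "mixed (Y t)" by (auto simp: mixed_def)
    have "k \<le> best (Y t)"
    proof (rule ccontr)
      assume "\<not> k \<le> best (Y t)"
      then have "min (V (Y t) (best (Y t))) (V (Y t) (best X)) < V (Y t) k"
        using elim mix k(2) by (intro V_strict_quasiconcave[where ?s0.0 = s1] best_adm) auto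
      moreover have "V (Y t) (best X) \<le> V (Y t) (best (Y t))"
        using mix elim by (intro best_max) auto
      ultimately show False using elim(1) by linarith
    qed
    then show ?case using mix k(1) by simp
  qed
qed

text \<open>The upper bound is the lower bound for the reflected payoff.\<close>

lemma tendsto_best:
  assumes X: "mixed X" and Y: "\<And>s. ((\<lambda>t. Y t s) \<longlongrightarrow> X s) F"
  shows "((\<lambda>t. best (Y t)) \<longlongrightarrow> best X) F"
proof (rule order_tendstoI)
  show "\<forall>\<^sub>F t in F. l < best (Y t)" if "l < best X" for l
    using tendsto_best_lower[where X = X and Y = Y and F = F, OF X Y that] by (rule eventually_mono) auto
  fix h assume "best X < h"
  then have "- h < best (\<lambda>s. - X s)" using best_minus[OF X] by simp
  then have "\<forall>\<^sub>F t in F. mixed (\<lambda>s. - Y t s) \<and> - h < best (\<lambda>s. - Y t s)"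
    by (intro tendsto_best_lower[where X = "\<lambda>s. - X s"] mixed_minus X tendsto_minus Y)
  then show "\<forall>\<^sub>F t in F. best (Y t) < h"
  proof eventually_elim
    case (elim t)
    then show ?case using best_minus[of "\<lambda>s. - Y t s"] by simp
  qed
qed

section \<open>Demand as a function of the price and the reservation interval\<close>

lemma optimal_position_eq: "optimal_position a S \<pi> = best (\<lambda>s. S s - \<pi>)"
  by (simp add: optimal_position_def best_def objective_eq admissible_eq)

lemma mixed_excess:
  assumes "Min (range S) < \<pi>" "\<pi> < Max (range S)"
  shows "mixed (\<lambda>s. S s - \<pi>)"
  using assms by (auto simp: mixed_def Min_less_iff Max_gr_iff)

lemma lower_reservation_eq: "lower_reservation a S = worst S"
  and upper_reservation_eq: "upper_reservation a S = - worst (\<lambda>s. - S s)"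
  using delta_nonneg
  by (simp_all add: lower_reservation_def upper_reservation_def worst_def expect_minus std_dev_minus)

lemma reservation_le: "lower_reservation a S \<le> upper_reservation a S"
proof -
  have "0 \<le> std_dev (ref a) S"
    by (auto simp: std_dev_def expect_def intro!: sum_nonneg mult_nonneg_nonneg less_imp_le[OF pos])
  then show ?thesis
    by (simp add: lower_reservation_def upper_reservation_def)
qed

text \<open>Places the reservation interval inside the open price range, so that its end points are
  themselves arbitrage-free prices.\<close>

lemma reservation_bounds:
  assumes "S s \<noteq> S t"
  shows "Min (range S) < lower_reservation a S" "upper_reservation a S < Max (range S)"
proof -
  show "Min (range S) < lower_reservation a S"
    using Min_less_worst[of S, OF assms] by (simp add: lower_reservation_eq)
  have "Min (range (\<lambda>s. - S s)) < worst (\<lambda>s. - S s)"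
    using Min_less_worst[of "\<lambda>s. - S s"] assms by simp
  then obtain s where "- S s < worst (\<lambda>s. - S s)" by (auto simp: Min_less_iff)
  then have "upper_reservation a S < S s" by (simp add: upper_reservation_eq)
  also have "\<dots> \<le> Max (range S)" by simp
  finally show "upper_reservation a S < Max (range S)" .
qed

text \<open>\<open>worst\<close> of the excess payoff is \<open>worst S - \<pi>\<close>, so
  \<open>best_pos_iff\<close> compares \<open>\<pi>\<close> with the lower reservation price;
  reflection gives the upper one.\<close>

lemma optimal_position_sign:
  assumes "Min (range S) < \<pi>" "\<pi> < Max (range S)"
  shows "0 < optimal_position a S \<pi> \<longleftrightarrow> \<pi> < lower_reservation a S"
    and "optimal_position a S \<pi> < 0 \<longleftrightarrow> upper_reservation a S < \<pi>"
proof -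
  note X = mixed_excess[OF assms]
  show "0 < optimal_position a S \<pi> \<longleftrightarrow> \<pi> < lower_reservation a S"
    using best_pos_iff[OF X] by (simp add: optimal_position_eq lower_reservation_eq worst_shift)
  have "worst (\<lambda>s. - (S s - \<pi>)) = worst (\<lambda>s. - S s) + \<pi>"
    using worst_shift[of "\<lambda>s. - S s" "- \<pi>"] by (simp add: algebra_simps)
  then show "optimal_position a S \<pi> < 0 \<longleftrightarrow> upper_reservation a S < \<pi>"
    using best_pos_iff[OF mixed_minus[OF X]] best_minus[OF X]
    by (auto simp: optimal_position_eq upper_reservation_eq)
qed

lemma continuous_optimal_position:
  "continuous_on {Min (range S)<..<Max (range S)} (optimal_position a S)"
  unfolding continuous_on_def optimal_position_eq
  by (intro ballI tendsto_best mixed_excess tendsto_intros) auto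

lemma ex1_optimal_position:
  assumes "Min (range S) < \<pi>" "\<pi> < Max (range S)"
  shows "\<exists>!\<theta>. is_arg_max (objective a S \<pi>) (\<lambda>\<theta>. \<theta> \<in> admissible a S \<pi>) \<theta>"
  unfolding objective_eq admissible_eq by (intro ex1_maximizer mixed_excess assms)

end

section \<open>Equilibrium\<close>

lemma sum_eq_0_obtains_signs:
  fixes f :: "'a \<Rightarrow> real"
  assumes "finite I" "sum f I = 0" "\<exists>i\<in>I. f i \<noteq> 0"
  obtains i j where "i \<in> I" "0 < f i" "j \<in> I" "f j < 0"
proof -
  have "\<exists>i\<in>I. 0 < f i"
  proof (rule ccontr)
    assume "\<not> (\<exists>i\<in>I. 0 < f i)"
    then have "\<And>i. i \<in> I \<Longrightarrow> 0 \<le> - f i" by force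
    moreover have "sum (\<lambda>i. - f i) I = 0" using assms(2) by (simp add: sum_negf)
    ultimately have "\<forall>i\<in>I. - f i = 0"
      using sum_nonneg_eq_0_iff[OF assms(1), of "\<lambda>i. - f i"] by blast
    then show False using assms(3) by simp
  qed
  moreover have "\<exists>j\<in>I. f j < 0"
  proof (rule ccontr)
    assume "\<not> (\<exists>j\<in>I. f j < 0)"
    then have "\<And>i. i \<in> I \<Longrightarrow> 0 \<le> f i" by force
    then show False using assms sum_nonneg_eq_0_iff[OF assms(1), of f] by blast
  qed
  ultimately show ?thesis using that by blast
qed

theorem theorem3p1:
  fixes S :: "'d::finite \<Rightarrow> real" and agent :: "nat \<Rightarrow> 'd investor" and m :: nat
  assumes "CARD('d) \<ge> 2"
    and "\<exists>s t. S s \<noteq> S t"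
    and "m \<ge> 2"
    and "\<And>i. i \<in> {1..m} \<Longrightarrow> investor_ok (agent i)"
    and "\<And>i. i \<in> {1..m} \<Longrightarrow> ambig (agent i) \<in> {1/2..1}"
  shows "(\<exists>\<pi>. equilibrium_price agent m S 0 \<pi>) \<and>
    (\<forall>\<pi>. equilibrium_price agent m S 0 \<pi> \<longrightarrow>
      ((\<exists>i\<in>{1..m}. optimal_position (agent i) S \<pi> \<noteq> 0) \<longleftrightarrow>
       Min ((\<lambda>i. upper_reservation (agent i) S) ` {1..m})
         < Max ((\<lambda>i. lower_reservation (agent i) S) ` {1..m})))"
proof -
  have inv: "averse_investor (agent i)" if "i \<in> {1..m}" for i
    using assms(4,5)[OF that] by unfold_locales auto
  obtain s t where st: "S s \<noteq> S t" using assms(2) by blast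
  have ne: "{1..m} \<noteq> {}" using assms(3) by simp
  let ?I = "{1..m}"
  let ?lo = "\<lambda>i. lower_reservation (agent i) S"
  let ?up = "\<lambda>i. upper_reservation (agent i) S"
  let ?\<theta> = "\<lambda>i. optimal_position (agent i) S"
  let ?l = "Min (range S)" and ?h = "Max (range S)"
  \<comment> \<open>At price \<open>\<alpha>\<close> nobody sells and at \<open>\<beta>\<close>
    nobody buys, so aggregate demand changes sign between them.\<close>
  define \<alpha> where "\<alpha> = Min (?lo ` ?I)"
  define \<beta> where "\<beta> = Max (?up ` ?I)"
  have \<alpha>: "?l < \<alpha>"
    using averse_investor.reservation_bounds(1)[OF inv st] ne by (auto simp: \<alpha>_def)
  have \<beta>: "\<beta> < ?h"
    using averse_investor.reservation_bounds(2)[OF inv st] ne by (auto simp: \<beta>_def)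
  have \<alpha>_le: "\<alpha> \<le> ?lo i" and le_\<beta>: "?up i \<le> \<beta>" if "i \<in> ?I" for i
    using that by (auto simp: \<alpha>_def \<beta>_def)
  have \<alpha>\<beta>: "\<alpha> \<le> \<beta>"
    using \<alpha>_le[of 1] le_\<beta>[of 1] averse_investor.reservation_le[OF inv[of 1], of S] assms(3) by simp
  have "continuous_on {\<alpha>..\<beta>} (\<lambda>\<pi>. \<Sum>i\<in>?I. ?\<theta> i \<pi>)"
    using \<alpha> \<beta>
    by (intro continuous_on_sum continuous_on_subset[OF averse_investor.continuous_optimal_position[OF inv]]) auto
  moreover have "0 \<le> (\<Sum>i\<in>?I. ?\<theta> i \<alpha>)"
  proof (rule sum_nonneg)
    fix i assume i: "i \<in> ?I"
    show "0 \<le> ?\<theta> i \<alpha>"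
      using averse_investor.optimal_position_sign(2)[OF inv[OF i], of S \<alpha>] \<alpha> \<beta> \<alpha>\<beta> \<alpha>_le[OF i]
        averse_investor.reservation_le[OF inv[OF i], of S] by linarith
  qed
  moreover have "(\<Sum>i\<in>?I. ?\<theta> i \<beta>) \<le> 0"
  proof (rule sum_nonpos)
    fix i assume i: "i \<in> ?I"
    show "?\<theta> i \<beta> \<le> 0"
      using averse_investor.optimal_position_sign(1)[OF inv[OF i], of S \<beta>] \<alpha> \<beta> \<alpha>\<beta> le_\<beta>[OF i]
        averse_investor.reservation_le[OF inv[OF i], of S] by linarith
  qed
  ultimately obtain \<pi> where \<pi>: "\<alpha> \<le> \<pi>" "\<pi> \<le> \<beta>" "(\<Sum>i\<in>?I. ?\<theta> i \<pi>) = 0"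
    using IVT2'[of "\<lambda>\<pi>. \<Sum>i\<in>?I. ?\<theta> i \<pi>" \<beta> 0 \<alpha>] \<alpha>\<beta> by blast
  then have "equilibrium_price agent m S 0 \<pi>"
    unfolding equilibrium_price_def
    using \<alpha> \<beta> averse_investor.ex1_optimal_position[OF inv] by auto
  moreover have "(\<exists>i\<in>?I. ?\<theta> i \<pi> \<noteq> 0) \<longleftrightarrow> Min (?up ` ?I) < Max (?lo ` ?I)"
    if eq: "equilibrium_price agent m S 0 \<pi>" for \<pi>
  proof -
    have \<pi>: "?l < \<pi>" "\<pi> < ?h" and sum0: "(\<Sum>i\<in>?I. ?\<theta> i \<pi>) = 0"
      using eq by (auto simp: equilibrium_price_def)
    note sgn = averse_investor.optimal_position_sign[OF inv \<pi>]
    have iff: "Min (?up ` ?I) < Max (?lo ` ?I) \<longleftrightarrow> (\<exists>i\<in>?I. \<exists>j\<in>?I. ?up j < ?lo i)"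
      using ne by (auto simp: Min_less_iff Max_gr_iff)
    show ?thesis unfolding iff
    proof
      assume nz: "\<exists>i\<in>?I. ?\<theta> i \<pi> \<noteq> 0"
      then obtain i j where ij: "i \<in> ?I" "0 < ?\<theta> i \<pi>" "j \<in> ?I" "?\<theta> j \<pi> < 0"
        using sum_eq_0_obtains_signs[OF _ sum0] by auto
      \<comment> \<open>The buyer \<open>i\<close> has \<open>?lo i\<close> above the price, the
        seller \<open>j\<close> has \<open>?up j\<close> below it.\<close>
      then have "?up j < ?lo i" using sgn(1)[of i] sgn(2)[of j] by linarith
      then show "\<exists>i\<in>?I. \<exists>j\<in>?I. ?up j < ?lo i" using ij by blast
    next
      assume "\<exists>i\<in>?I. \<exists>j\<in>?I. ?up j < ?lo i"
      then obtain i j where ij: "i \<in> ?I" "j \<in> ?I" "?up j < ?lo i" by blast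
      \<comment> \<open>No price lies in both of two disjoint intervals, so \<open>i\<close> buys or
        \<open>j\<close> sells.\<close>
      then have "\<pi> < ?lo i \<or> ?up j < \<pi>" by linarith
      then show "\<exists>i\<in>?I. ?\<theta> i \<pi> \<noteq> 0"
        using sgn(1)[OF ij(1)] sgn(2)[OF ij(2)] ij(1,2) by force
    qed
  qed
  ultimately show ?thesis by blast
qed

end
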